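(* There exists an absolute constant $C$ such that, for any integers $s\ge1$ and $d\ge3$ satisfying $s\le\sqrt d$, and any $\sigma>0$, $$\sup_{\theta\in B_0(s)} \mathbf E_\theta\big(\tilde L - L(\theta)\big)^2 \le C\,\sigma^2s^2\log(1+d/s^2).$$
   Context: Model: one observes $y_j=\theta_j+\sigma\xi_j$, $j=1,\dots,d$, where $\theta=(\theta_1,\dots,\theta_d)\in\mathbb R^d$ is unknown, $\xi_1,\dots,\xi_d$ are i.i.d. standard normal and $\sigma>0$. $\mathbf P_\theta$ is the law of $(y_1,\dots,y_d)$ and $\mathbf E_\theta$ the corresponding expectation. $L(\theta)=\sum_{i=1}^d\theta_i$; $\|\theta\|_0$ is the number of non-zero components of $\theta$; $B_0(s)=\{\theta\in\mathbb R^d:\|\theta\|_0\le s\}$. Let $y_{(1)}^2\le\dots\le y_{(d)}^2$ be the order statistics of $y_1^2,\dots,y_d^2$ and set $$\hat\sigma=3\Big(\frac1d\sum_{j\le d-\sqrt d}y_{(j)}^2\Big)^{1/2},\qquad \tilde L=\sum_{j=1}^d y_j\,\mathbf 1_{\{|y_j|>\hat\sigma\sqrt{2\log(1+d/s^2)}\}}.$$ *)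

theory Defs
  imports "HOL-Probability.Probability"
begin

text \<open>
  The dimension is a number that is quantified inside the theorem, so a vector of length \<open>d\<close> is a
  function on \<open>{1..d}\<close> that is undefined elsewhere, i.e. an element of \<open>{1..d} \<rightarrow>\<^sub>E UNIV\<close>.
\<close>

definition noise_law :: "nat \<Rightarrow> (nat \<Rightarrow> real) measure" where
  "noise_law d = (\<Pi>\<^sub>M j\<in>{1..d}. density lborel std_normal_density)"

definition obs_law :: "nat \<Rightarrow> real \<Rightarrow> (nat \<Rightarrow> real) \<Rightarrow> (nat \<Rightarrow> real) measure" where
  "obs_law d \<sigma> \<theta> =
     distr (noise_law d) (\<Pi>\<^sub>M j\<in>{1..d}. borel) (\<lambda>\<xi>. \<lambda>j\<in>{1..d}. \<theta> j + \<sigma> * \<xi> j)"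

text \<open>The map in \<open>obs_law\<close> is measurable, so the push-forward is not degenerate.\<close>

lemma prob_space_obs_law: "prob_space (obs_law d \<sigma> \<theta>)"
proof -
  let ?N = "density lborel (\<lambda>x. ennreal (std_normal_density x))"
  interpret N: prob_space ?N
    by (rule prob_space_normal_density) simp
  interpret P: prob_space "noise_law d"
    unfolding noise_law_def by (rule prob_space_PiM) (rule N.prob_space_axioms)
  have [measurable]: "(\<lambda>\<xi>. \<xi> j) \<in> borel_measurable (noise_law d)" if "j \<in> {1..d}" for j
    using measurable_component_singleton[OF that, of "\<lambda>_. ?N"]
    by (simp add: noise_law_def)
  have "(\<lambda>\<xi>. \<lambda>j\<in>{1..d}. \<theta> j + \<sigma> * \<xi> j) \<in> noise_law d \<rightarrow>\<^sub>M (\<Pi>\<^sub>M j\<in>{1..d}. borel)"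
    by (rule measurable_restrict) measurable
  then show ?thesis
    unfolding obs_law_def by (rule P.prob_space_distr)
qed

definition l0_norm :: "nat \<Rightarrow> (nat \<Rightarrow> real) \<Rightarrow> nat" where
  "l0_norm d \<theta> = card {j \<in> {1..d}. \<theta> j \<noteq> 0}"

definition B0 :: "nat \<Rightarrow> nat \<Rightarrow> (nat \<Rightarrow> real) set" where
  "B0 d s = {\<theta> \<in> {1..d} \<rightarrow>\<^sub>E UNIV. l0_norm d \<theta> \<le> s}"

definition L :: "nat \<Rightarrow> (nat \<Rightarrow> real) \<Rightarrow> real" where
  "L d \<theta> = (\<Sum>i=1..d. \<theta> i)"

text \<open>
  The \<open>k\<close>-th smallest of \<open>z 1, \<dots>, z d\<close>, for \<open>1 \<le> k \<le> d\<close>; list positions start at \<open>0\<close>.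
\<close>

definition order_stat :: "nat \<Rightarrow> (nat \<Rightarrow> real) \<Rightarrow> nat \<Rightarrow> real" where
  "order_stat d z k = sort (map z [1..<Suc d]) ! (k - 1)"

definition sigma_hat :: "nat \<Rightarrow> (nat \<Rightarrow> real) \<Rightarrow> real" where
  "sigma_hat d y =
     3 * sqrt (1 / real d *
       (\<Sum>j | j \<in> {1..d} \<and> real j \<le> real d - sqrt (real d). order_stat d (\<lambda>i. (y i)\<^sup>2) j))"

definition L_tilde :: "nat \<Rightarrow> nat \<Rightarrow> (nat \<Rightarrow> real) \<Rightarrow> real" where
  "L_tilde d s y =
     (\<Sum>j=1..d. y j *
        indicator {t. \<bar>t\<bar> > sigma_hat d y * sqrt (2 * ln (1 + real d / (real s)\<^sup>2))} (y j))"

end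

theory Submission
  imports Defs "HOL-Combinatorics.Permutations" "HOL-Real_Asymp.Real_Asymp"
begin

text \<open>
  The error splits over the support \<open>S\<close> of \<open>\<theta>\<close>. On \<open>S\<close>, thresholding costs at most
  \<open>\<sigma>|\<xi>\<^sub>j| + t \<sigma>hat\<close> per coordinate, where \<open>t\<^sup>2 = 2 log (1 + d/s\<^sup>2)\<close>, and
  \<open>E \<sigma>hat\<^sup>2 \<le> 9 \<sigma>\<^sup>2\<close> because the trimmed sum of squares is at most the sum of squares off \<open>S\<close>.
  Off \<open>S\<close>, the surviving noise terms are pairwise orthogonal, since \<open>\<sigma>hat\<close> is invariant under
  flipping the sign of a single noise variable. So only their second moments matter; these are
  Gaussian tail integrals as long as \<open>\<sigma>hat \<ge> \<sigma>\<close>. For large \<open>d\<close>, the event \<open>\<sigma>hat < \<sigma>\<close> forces half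
  of the noise variables into \<open>(-1/2, 1/2)\<close>, which has exponentially small probability.
\<close>

subsection \<open>Order statistics and the scale estimator\<close>

lemma order_stat_mono:
  assumes "1 \<le> j" "j \<le> k" "k \<le> d"
  shows "order_stat d z j \<le> order_stat d z k"
  unfolding order_stat_def using assms by (intro sorted_nth_mono) auto

text \<open>Sorting permutes list positions, which start at 0. Conjugating that permutation with the
  shift \<open>k \<mapsto> k - 1\<close> yields a bijection of the indices 1 to d.\<close>

lemma order_stat_permutation:
  obtains \<pi> where "bij_betw \<pi> {1..d} {1..d}" "\<And>k. k \<in> {1..d} \<Longrightarrow> order_stat d z k = z (\<pi> k)"
proof -
  define xs where "xs = map z [1..<Suc d]"
  obtain p where p: "p permutes {..<length xs}" "permute_list p xs = sort xs"
    using mset_eq_permutation[of "sort xs" xs] by auto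
  have len: "length xs = d" by (simp add: xs_def)
  define \<pi> where "\<pi> k = Suc (p (k - 1))" for k
  have "bij_betw (Suc \<circ> (p \<circ> (\<lambda>k. k - 1))) {1..d} {1..d}"
  proof (intro bij_betw_trans)
    show "bij_betw (\<lambda>k. k - 1) {1..d} {..<d}"
      by (rule bij_betw_byWitness[where f' = Suc]) auto
    show "bij_betw p {..<d} {..<d}"
      using permutes_imp_bij[OF p(1)] len by simp
    show "bij_betw Suc {..<d} {1..d}"
      by (rule bij_betw_byWitness[where f' = "\<lambda>k. k - 1"]) auto
  qed
  then have bij: "bij_betw \<pi> {1..d} {1..d}"
    by (simp add: \<pi>_def[abs_def] comp_def)
  have val: "order_stat d z k = z (\<pi> k)" if "k \<in> {1..d}" for k
  proof -
    have "order_stat d z k = permute_list p xs ! (k - 1)"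
      unfolding order_stat_def xs_def[symmetric] p(2) ..
    also have "\<dots> = xs ! p (k - 1)"
      using that len by (intro permute_list_nth p(1)) auto
    also have "p (k - 1) < d"
      using permutes_in_image[OF p(1), of "k - 1"] that len by auto
    then have "xs ! p (k - 1) = z (\<pi> k)"
      by (simp add: xs_def \<pi>_def nth_append del: upt_Suc)
    finally show ?thesis .
  qed
  show ?thesis using that bij val by blast
qed

text \<open>\<open>J\<close> collects the coordinates holding the m lowest ranks. The last property,
  a consequence of the sorted order, is what the exchange argument for minimality needs.\<close>

lemma sum_order_stat_attained:
  assumes "m \<le> d"
  obtains J where "J \<subseteq> {1..d}" "card J = m" "(\<Sum>k=1..m. order_stat d z k) = sum z J"
    "\<And>i j. i \<in> J \<Longrightarrow> j \<in> {1..d} - J \<Longrightarrow> z i \<le> z j"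
proof -
  obtain \<pi> where \<pi>: "bij_betw \<pi> {1..d} {1..d}" "\<And>k. k \<in> {1..d} \<Longrightarrow> order_stat d z k = z (\<pi> k)"
    using order_stat_permutation[of d z] by blast
  have inj: "inj_on \<pi> {1..m}"
    using \<pi>(1) assms by (auto simp: bij_betw_def intro: inj_on_subset)
  show thesis
  proof
    show "\<pi> ` {1..m} \<subseteq> {1..d}" using \<pi>(1) assms by (auto simp: bij_betw_def)
    show "card (\<pi> ` {1..m}) = m" using inj by (simp add: card_image)
    show "(\<Sum>k=1..m. order_stat d z k) = sum z (\<pi> ` {1..m})"
      using inj assms by (subst sum.reindex) (auto intro!: sum.cong \<pi>(2))
    fix i j assume i: "i \<in> \<pi> ` {1..m}" and j: "j \<in> {1..d} - \<pi> ` {1..m}"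
    obtain i' where i': "i = \<pi> i'" "i' \<in> {1..m}" using i by auto
    have "{1..d} = \<pi> ` {1..d}" using \<pi>(1) by (simp add: bij_betw_def)
    then obtain j' where j': "j = \<pi> j'" "j' \<in> {1..d}" using j by blast
    have "m < j'" using j j' by force
    have "order_stat d z i' \<le> order_stat d z j'"
      using i' j' \<open>m < j'\<close> by (intro order_stat_mono) auto
    then show "z i \<le> z j" using i' j' assms by (simp add: \<pi>(2))
  qed
qed

text \<open>Exchange argument: \<open>J - T\<close> and \<open>T - J\<close> have equal size, and
  every value on the former is at most every value on the latter, so swapping one for the other
  cannot lower the sum.\<close>

lemma sum_order_stat_le:
  assumes T: "T \<subseteq> {1..d}" "card T = m"
  shows "(\<Sum>k=1..m. order_stat d z k) \<le> sum z T"
proof -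
  have fin: "finite T" using T(1) finite_subset by blast
  have "m \<le> d" using card_mono[OF _ T(1)] T(2) by simp
  then obtain J where J: "J \<subseteq> {1..d}" "card J = m" "(\<Sum>k=1..m. order_stat d z k) = sum z J"
    "\<And>i j. i \<in> J \<Longrightarrow> j \<in> {1..d} - J \<Longrightarrow> z i \<le> z j"
    by (rule sum_order_stat_attained[of m d z]) blast
  have finJ: "finite J" using J(1) finite_subset by blast
  have "card (J - T) = card (T - J)"
    using J(2) T(2) fin finJ by (metis card_le_sym_Diff diff_is_0_eq' le_antisym order_refl)
  then obtain h where h: "bij_betw h (J - T) (T - J)"
    using finite_same_card_bij[of "J - T" "T - J"] fin finJ by auto
  have "sum z (J - T) \<le> (\<Sum>i\<in>J - T. z (h i))"
    using T(1) bij_betwE[OF h] by (intro sum_mono J(4)) auto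
  also have "\<dots> = sum z (T - J)"
    using sum.reindex_bij_betw[OF h] .
  finally show ?thesis
    using sum.Int_Diff[OF finJ, of z T] sum.Int_Diff[OF fin, of z J] J(3) by (simp add: Int_commute)
qed

text \<open>This form removes the sorting: a minimum of finitely many subset sums is visibly
  measurable in the data.\<close>

lemma sum_order_stat_eq_Min:
  assumes "m \<le> d"
  shows "(\<Sum>k=1..m. order_stat d z k) = Min (sum z ` {T. T \<subseteq> {1..d} \<and> card T = m})"
proof (rule sym, rule Min_eqI)
  show "finite (sum z ` {T. T \<subseteq> {1..d} \<and> card T = m})" by simp
  show "(\<Sum>k=1..m. order_stat d z k) \<in> sum z ` {T. T \<subseteq> {1..d} \<and> card T = m}"
    by (rule sum_order_stat_attained[OF assms, of z]) auto
  fix v assume "v \<in> sum z ` {T. T \<subseteq> {1..d} \<and> card T = m}"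
  then obtain T where "T \<subseteq> {1..d}" "card T = m" "v = sum z T" by blast
  then show "(\<Sum>k=1..m. order_stat d z k) \<le> v" using sum_order_stat_le[of T d m z] by simp
qed

section \<open>The trimming level and the scale estimator\<close>

definition kept :: "nat \<Rightarrow> nat" where
  "kept d = nat \<lfloor>real d - sqrt (real d)\<rfloor>"

lemma kept_bounds:
  assumes "d \<ge> 1"
  shows "real (kept d) \<le> real d - sqrt (real d)" "real d - sqrt (real d) - 1 < real (kept d)"
proof -
  have "sqrt (real d) \<le> real d"
    using assms by (intro real_le_lsqrt) (auto simp: power2_eq_square)
  then show "real (kept d) \<le> real d - sqrt (real d)" "real d - sqrt (real d) - 1 < real (kept d)"
    unfolding kept_def by linarith+
qed

lemma kept_le: "kept d \<le> d"
proof (cases "d = 0")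
  case False
  have "0 \<le> sqrt (real d)" by simp
  then show ?thesis using kept_bounds(1)[of d] False by linarith
qed (simp add: kept_def)

lemma sigma_hat_eq:
  assumes "d \<ge> 1"
  shows "sigma_hat d y = 3 * sqrt (1 / real d * (\<Sum>k=1..kept d. order_stat d (\<lambda>i. (y i)\<^sup>2) k))"
proof -
  have "{j. j \<in> {1..d} \<and> real j \<le> real d - sqrt (real d)} = {1..kept d}"
  proof -
    have "real j \<le> real d - sqrt (real d) \<longleftrightarrow> j \<le> kept d" if "j \<ge> 1" for j
      using that unfolding kept_def by linarith
    then show ?thesis using kept_le[of d] by auto
  qed
  then show ?thesis by (simp add: sigma_hat_def)
qed

lemma sigma_hat_squared:
  assumes "d \<ge> 1"
  shows "(sigma_hat d y)\<^sup>2 = 9 / real d * (\<Sum>k=1..kept d. order_stat d (\<lambda>i. (y i)\<^sup>2) k)"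
    and "sigma_hat d y \<ge> 0"
proof -
  obtain J where "(\<Sum>k=1..kept d. order_stat d (\<lambda>i. (y i)\<^sup>2) k) = (\<Sum>i\<in>J. (y i)\<^sup>2)"
    by (rule sum_order_stat_attained[OF kept_le, of d "\<lambda>i. (y i)\<^sup>2"])
  then have "0 \<le> (\<Sum>k=1..kept d. order_stat d (\<lambda>i. (y i)\<^sup>2) k)"
    by (simp add: sum_nonneg)
  then show "(sigma_hat d y)\<^sup>2 = 9 / real d * (\<Sum>k=1..kept d. order_stat d (\<lambda>i. (y i)\<^sup>2) k)"
    "sigma_hat d y \<ge> 0"
    by (simp_all add: sigma_hat_eq[OF assms] power_mult_distrib)
qed

text \<open>Only squares of the data enter, which gives the invariance under sign flips used for
  orthogonality of the surviving noise.\<close>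

lemma sigma_hat_cong:
  assumes "\<And>i. i \<in> {1..d} \<Longrightarrow> (y i)\<^sup>2 = (y' i)\<^sup>2"
  shows "sigma_hat d y = sigma_hat d y'"
proof -
  have "map (\<lambda>i. (y i)\<^sup>2) [1..<Suc d] = map (\<lambda>i. (y' i)\<^sup>2) [1..<Suc d]"
    using assms by (intro map_cong) auto
  then show ?thesis unfolding sigma_hat_def order_stat_def by metis
qed

lemma borel_measurable_sigma_hat [measurable]:
  assumes "d \<ge> 1" and "\<And>i. i \<in> {1..d} \<Longrightarrow> (\<lambda>x. y x i) \<in> borel_measurable M"
  shows "(\<lambda>x. sigma_hat d (y x)) \<in> borel_measurable M"
proof -
  have "(\<lambda>x. \<Sum>i\<in>T. (y x i)\<^sup>2) \<in> borel_measurable M" if "T \<subseteq> {1..d}" for T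
    using that assms(2) by (intro borel_measurable_sum borel_measurable_power) auto
  then have "(\<lambda>x. Min ((\<lambda>T. \<Sum>i\<in>T. (y x i)\<^sup>2) ` {T. T \<subseteq> {1..d} \<and> card T = kept d}))
      \<in> borel_measurable M"
    by (intro borel_measurable_Min) auto
  then show ?thesis
    unfolding sigma_hat_eq[OF assms(1)] sum_order_stat_eq_Min[OF kept_le] by measurable
qed

text \<open>Since \<open>S\<close> has at most sqrt d elements, its complement contains a set of
  \<open>kept d\<close> coordinates. The trimmed sum, minimal among sums of that many squares, is at
  most the sum over this set, whatever the values on \<open>S\<close>.\<close>

lemma sigma_hat_squared_le:
  assumes "d \<ge> 1" "S \<subseteq> {1..d}" "real (card S) \<le> sqrt (real d)"
  shows "(sigma_hat d y)\<^sup>2 \<le> 9 / real d * (\<Sum>i\<in>{1..d} - S. (y i)\<^sup>2)"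
proof -
  have "card ({1..d} - S) = d - card S"
    using assms(2) by (subst card_Diff_subset) (auto intro: finite_subset)
  moreover have "kept d \<le> d - card S"
    using kept_bounds(1)[OF assms(1)] assms(3) by linarith
  ultimately obtain T where T: "T \<subseteq> {1..d} - S" "card T = kept d"
    by (metis obtain_subset_with_card_n)
  have "(\<Sum>k=1..kept d. order_stat d (\<lambda>i. (y i)\<^sup>2) k) \<le> (\<Sum>i\<in>T. (y i)\<^sup>2)"
    using T by (intro sum_order_stat_le) auto
  also have "\<dots> \<le> (\<Sum>i\<in>{1..d} - S. (y i)\<^sup>2)"
    using T by (intro sum_mono2) auto
  finally show ?thesis
    unfolding sigma_hat_squared(1)[OF assms(1)] by (rule mult_left_mono) simp
qed

text \<open>At least \<open>kept d - s\<close> of the retained coordinates carry pure noise, so an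
  underestimate forces half of the noise variables into \<open>(-1/2, 1/2)\<close>.\<close>

lemma sigma_hat_less_imp:
  assumes d: "d \<ge> 1600" and S: "S \<subseteq> {1..d}" "real (card S) \<le> sqrt (real d)"
    and \<sigma>: "\<sigma> > 0" and y: "\<And>i. i \<in> {1..d} - S \<Longrightarrow> y i = \<sigma> * \<xi> i"
    and less: "sigma_hat d y < \<sigma>"
  shows "real d / 2 \<le> real (card {i \<in> {1..d}. \<bar>\<xi> i\<bar> < 1 / 2})"
proof -
  have d1: "d \<ge> 1" using d by simp
  obtain J where J: "J \<subseteq> {1..d}" "card J = kept d"
    "(\<Sum>k=1..kept d. order_stat d (\<lambda>i. (y i)\<^sup>2) k) = (\<Sum>i\<in>J. (y i)\<^sup>2)"
    by (rule sum_order_stat_attained[OF kept_le, of d "\<lambda>i. (y i)\<^sup>2"])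
  have finS: "finite S" using S(1) by (rule finite_subset) simp
  have finJ: "finite J" using J(1) by (rule finite_subset) simp
  define Z where "Z = {i \<in> {1..d}. \<bar>\<xi> i\<bar> < 1 / 2}"
  \<comment> \<open>These are the retained pure-noise coordinates outside the central interval; each
    contributes at least \<sigma>^2/4 to the trimmed sum.\<close>
  define K where "K = J - S - Z"
  have finK: "finite K" using finJ by (simp add: K_def)
  have "\<sigma>\<^sup>2 / 4 * real (card K) = (\<Sum>i\<in>K. \<sigma>\<^sup>2 / 4)" by simp
  also have "\<dots> \<le> (\<Sum>i\<in>K. (y i)\<^sup>2)"
  proof (rule sum_mono)
    fix i assume i: "i \<in> K"
    then have "\<bar>\<xi> i\<bar> \<ge> 1 / 2" "y i = \<sigma> * \<xi> i"
      using J(1) y by (auto simp: K_def Z_def)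
    moreover have "(1 / 2)\<^sup>2 \<le> \<bar>\<xi> i\<bar>\<^sup>2" using \<open>\<bar>\<xi> i\<bar> \<ge> 1 / 2\<close> by (intro power_mono) auto
    then have "1 / 4 \<le> (\<xi> i)\<^sup>2" by (simp add: power2_eq_square)
    ultimately show "\<sigma>\<^sup>2 / 4 \<le> (y i)\<^sup>2"
      using mult_left_mono[of "1 / 4" "(\<xi> i)\<^sup>2" "\<sigma>\<^sup>2"] by (simp add: power_mult_distrib)
  qed
  also have "\<dots> \<le> (\<Sum>i\<in>J. (y i)\<^sup>2)"
    using finJ by (intro sum_mono2) (auto simp: K_def)
  finally have "9 / real d * (\<sigma>\<^sup>2 / 4 * real (card K)) \<le> (sigma_hat d y)\<^sup>2"
    unfolding sigma_hat_squared(1)[OF d1] J(3) by (rule mult_left_mono) simp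
  also have "\<dots> < \<sigma>\<^sup>2"
    using less sigma_hat_squared(2)[OF d1, of y] by (intro power_strict_mono) auto
  \<comment> \<open>The factor 3 in the estimator is what makes this count less than 4d/9, leaving
    room for more than half of the coordinates in \<open>Z\<close>.\<close>
  finally have K: "9 * real (card K) < 4 * real d"
    using \<sigma> d by (simp add: field_simps)
  have "card J \<le> card (K \<union> S \<union> Z)"
  proof (rule card_mono)
    show "finite (K \<union> S \<union> Z)" using finK finS by (simp add: Z_def)
    show "J \<subseteq> K \<union> S \<union> Z" by (auto simp: K_def)
  qed
  also have "\<dots> \<le> card K + card S + card Z"
    by (meson add_mono card_Un_le le_trans order_refl)
  finally have "real d - sqrt (real d) - 1 < real (card K) + real (card S) + real (card Z)"
    using kept_bounds(2)[OF d1] J(2) by linarith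
  \<comment> \<open>The bound 1600 is 40^2. It gives sqrt d \<le> d/40, so d - 4d/9 - 2 sqrt d - 1
    is at least d/2 + d/180 - 1, which exceeds d/2.\<close>
  moreover have "40 * sqrt (real d) \<le> real d"
  proof -
    have "40 \<le> sqrt (real d)" using d by (intro real_le_rsqrt) auto
    then have "40 * sqrt (real d) \<le> sqrt (real d) * sqrt (real d)" by (intro mult_right_mono) auto
    then show ?thesis by simp
  qed
  ultimately show ?thesis using K S(2) d unfolding Z_def by linarith
qed

subsection \<open>The standard normal law\<close>

text \<open>The density is even and Lebesgue measure is invariant under reflection.\<close>

lemma distr_std_normal_uminus:
  "distr std_normal_distribution std_normal_distribution uminus = std_normal_distribution"
proof (rule measure_eqI)
  fix A assume A: "A \<in> sets (distr std_normal_distribution std_normal_distribution uminus)"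
  then have [measurable]: "A \<in> sets borel" by simp
  have "emeasure (distr std_normal_distribution std_normal_distribution uminus) A =
    emeasure std_normal_distribution (uminus -` A)"
    by (subst emeasure_distr) auto
  also have "\<dots> = (\<integral>\<^sup>+x. ennreal (std_normal_density x) * indicator (uminus -` A) x \<partial>lborel)"
    by (subst emeasure_density) (auto intro: measurable_sets_borel[OF _ \<open>A \<in> sets borel\<close>])
  also have "\<dots> = (\<integral>\<^sup>+x. ennreal (std_normal_density x) * indicator A x \<partial>distr lborel borel uminus)"
    by (subst nn_integral_distr) (auto simp: normal_density_def indicator_def intro!: nn_integral_cong)
  also have "\<dots> = emeasure std_normal_distribution A"
    by (subst emeasure_density) (auto simp: lborel_distr_uminus)
  finally show "emeasure (distr std_normal_distribution std_normal_distribution uminus) A =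
    emeasure std_normal_distribution A" .
qed simp

lemma nn_integral_std_normal_square:
  "(\<integral>\<^sup>+x. ennreal (x\<^sup>2) \<partial>std_normal_distribution) = 1"
proof -
  have "(\<integral>\<^sup>+x. ennreal (x\<^sup>2) \<partial>std_normal_distribution) =
      (\<integral>\<^sup>+x. ennreal (std_normal_density x * x ^ (2 * 1)) \<partial>lborel)"
    by (simp add: nn_integral_density ennreal_mult')
  also have "\<dots> = ennreal (fact (2 * 1) / (2 ^ 1 * fact 1))"
    using std_normal_moment_even[of 1]
    by (subst nn_integral_eq_integral) (auto simp: has_bochner_integral_iff)
  finally show ?thesis by (simp add: fact_numeral)
qed

text \<open>For \<open>x\<^sup>2 \<ge> 4/3\<close> the integrand is at most \<open>4 (x\<^sup>2 - 1) \<phi>(x)\<close>, the derivative of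
  \<open>-4 x \<phi>(x)\<close>.\<close>

lemma nn_integral_std_normal_tail_le:
  assumes t: "t > 0" "t\<^sup>2 \<ge> 4 / 3"
  shows "(\<integral>\<^sup>+x. ennreal (x\<^sup>2) * indicator {x. \<bar>x\<bar> > t} x \<partial>std_normal_distribution)
    \<le> ennreal (4 * t\<^sup>2 * exp (- t\<^sup>2 / 2))"
proof -
  let ?N = std_normal_distribution
  define F where "F x = - 4 * (x * std_normal_density x)" for x :: real
  define c where "c = 1 / sqrt (2 * pi)"
  have F_eq: "F = (\<lambda>x. - 4 * (x * (c * exp (- x\<^sup>2 / 2))))"
    by (simp add: fun_eq_iff F_def c_def std_normal_density_def)
  define f where "f x = 4 * (x\<^sup>2 - 1) * std_normal_density x" for x :: real
  have t1: "t \<ge> 1" using t by (intro power2_le_imp_le[of 1 t]) auto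
  have ge: "4 / 3 \<le> x\<^sup>2" if "t \<le> x" for x
    using power_mono[OF that, of 2] t by simp
  have "(\<integral>\<^sup>+x. ennreal (x\<^sup>2) * indicator {t..} x \<partial>?N) =
      (\<integral>\<^sup>+x. ennreal (x\<^sup>2 * std_normal_density x) * indicator {t..} x \<partial>lborel)"
    by (subst nn_integral_density)
      (auto intro!: nn_integral_cong simp: ennreal_mult' mult_ac split: split_indicator)
  also have "\<dots> \<le> (\<integral>\<^sup>+x. ennreal (f x) * indicator {t..} x \<partial>lborel)"
  proof (rule nn_integral_mono)
    fix x :: real
    show "ennreal (x\<^sup>2 * std_normal_density x) * indicator {t..} x \<le> ennreal (f x) * indicator {t..} x"
    proof (cases "t \<le> x")
      case True
      then have "x\<^sup>2 * std_normal_density x \<le> f x"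
        using ge[OF True] unfolding f_def by (intro mult_right_mono) auto
      then show ?thesis by (intro mult_right_mono ennreal_leI) auto
    qed simp
  qed
  also have "\<dots> = 0 - F t"
  proof (rule nn_integral_FTC_atLeast)
    show "f \<in> borel_measurable borel" unfolding f_def by measurable
    show "(F has_real_derivative f x) (at x)" for x
      unfolding F_eq f_def std_normal_density_def c_def[symmetric]
      by (auto intro!: derivative_eq_intros simp: field_simps power2_eq_square)
    show "0 \<le> f x" if "t \<le> x" for x
      using ge[OF that] by (simp add: f_def)
    show "(F \<longlongrightarrow> 0) at_top"
      unfolding F_def std_normal_density_def by real_asymp
  qed
  finally have half: "(\<integral>\<^sup>+x. ennreal (x\<^sup>2) * indicator {t..} x \<partial>?N) \<le> ennreal (4 * (t * std_normal_density t))"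
    by (simp add: F_def)
  \<comment> \<open>Reflection preserves the law and carries the left tail to the right
    tail.\<close>
  have "(\<integral>\<^sup>+x. ennreal (x\<^sup>2) * indicator {..-t} x \<partial>?N) =
      (\<integral>\<^sup>+x. ennreal (x\<^sup>2) * indicator {..-t} x \<partial>distr ?N ?N uminus)"
    by (simp add: distr_std_normal_uminus)
  also have "\<dots> = (\<integral>\<^sup>+x. ennreal (x\<^sup>2) * indicator {t..} x \<partial>?N)"
    by (subst nn_integral_distr) (auto intro!: nn_integral_cong split: split_indicator)
  finally have other: "(\<integral>\<^sup>+x. ennreal (x\<^sup>2) * indicator {..-t} x \<partial>?N) =
    (\<integral>\<^sup>+x. ennreal (x\<^sup>2) * indicator {t..} x \<partial>?N)" .
  have "(\<integral>\<^sup>+x. ennreal (x\<^sup>2) * indicator {x. \<bar>x\<bar> > t} x \<partial>?N) \<le>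
    (\<integral>\<^sup>+x. ennreal (x\<^sup>2) * indicator {t..} x + ennreal (x\<^sup>2) * indicator {..-t} x \<partial>?N)"
    by (intro nn_integral_mono) (auto split: split_indicator)
  also have "\<dots> = (\<integral>\<^sup>+x. ennreal (x\<^sup>2) * indicator {t..} x \<partial>?N) + (\<integral>\<^sup>+x. ennreal (x\<^sup>2) * indicator {..-t} x \<partial>?N)"
    by (intro nn_integral_add) auto
  also have "\<dots> \<le> ennreal (4 * (t * std_normal_density t)) + ennreal (4 * (t * std_normal_density t))"
    unfolding other by (intro add_mono half)
  also have "\<dots> = ennreal (8 * (t * std_normal_density t))"
    using t by (subst ennreal_plus[symmetric]) auto
  also have "\<dots> \<le> ennreal (4 * t\<^sup>2 * exp (- t\<^sup>2 / 2))"
  proof (rule ennreal_leI)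
    \<comment> \<open>This halves the leading constant; t \<ge> 1 then allows t to be raised to t^2,
      so that with t^2 = 2 \<open>rate\<close> the bound becomes a multiple of
      \<open>rate\<close>.\<close>
    have "2 \<le> sqrt (2 * pi)"
      using pi_gt3 by (intro real_le_rsqrt) auto
    then have "std_normal_density t \<le> exp (- t\<^sup>2 / 2) / 2"
      unfolding std_normal_density_def by (simp add: field_simps)
    then have "8 * (t * std_normal_density t) \<le> 8 * (t * (exp (- t\<^sup>2 / 2) / 2))"
      using t by (intro mult_left_mono) auto
    also have "\<dots> = 4 * (t * 1) * exp (- t\<^sup>2 / 2)" by simp
    also have "\<dots> \<le> 4 * (t * t) * exp (- t\<^sup>2 / 2)"
      using t t1 by (intro mult_right_mono mult_left_mono) auto
    finally show "8 * (t * std_normal_density t) \<le> 4 * t\<^sup>2 * exp (- t\<^sup>2 / 2)"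
      by (simp add: power2_eq_square)
  qed
  finally show ?thesis .
qed

text \<open>The interval has length 1 and the density is at most 1/sqrt(2 pi) \<le> 2/5.\<close>

lemma emeasure_std_normal_central_le:
  "emeasure std_normal_distribution {x. \<bar>x\<bar> < 1 / 2} \<le> ennreal (2 / 5)"
proof -
  have le: "std_normal_density x \<le> 2 / 5" for x
  proof -
    have "5 / 2 \<le> sqrt (2 * pi)"
      using pi_approx by (intro real_le_rsqrt) (auto simp: power2_eq_square)
    moreover have "exp (- x\<^sup>2 / 2) \<le> 1" by simp
    ultimately have "exp (- x\<^sup>2 / 2) / sqrt (2 * pi) \<le> 1 / (5 / 2)"
      by (intro frac_le) auto
    then show ?thesis by (simp add: std_normal_density_def)
  qed
  have "emeasure std_normal_distribution {x. \<bar>x\<bar> < 1 / 2} =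
      (\<integral>\<^sup>+x. ennreal (std_normal_density x) * indicator {x. \<bar>x\<bar> < 1 / 2} x \<partial>lborel)"
    by (subst emeasure_density) auto
  also have "\<dots> \<le> (\<integral>\<^sup>+x. ennreal (2 / 5) * indicator {-1/2<..<1/2::real} x \<partial>lborel)"
    using le by (intro nn_integral_mono) (auto split: split_indicator intro: ennreal_leI)
  also have "\<dots> = ennreal (2 / 5)"
    by (subst nn_integral_cmult) auto
  finally show ?thesis .
qed

text \<open>
  The product of the tilts is at least \<open>1\<close> once half of the variables lie in \<open>(-1/2, 1/2)\<close>, although
  each tilt has mean below \<open>1\<close>: this is a Chernoff bound with weight \<open>6/5\<close>.
\<close>

definition tilt :: "real \<Rightarrow> real" where
  "tilt x = (if \<bar>x\<bar> < 1 / 2 then 6 / 5 else 5 / 6)"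

lemma tilt_pos: "0 < tilt x" and tilt_le: "tilt x \<le> 6 / 5"
  by (auto simp: tilt_def)

lemma borel_measurable_tilt [measurable]: "tilt \<in> borel_measurable borel"
  unfolding tilt_def by measurable

text \<open>With 11/30 = 6/5 - 5/6, the mean is 5/6 plus 11/30 times the central probability, hence
  at most 5/6 + (11/30)(2/5) = 49/50.\<close>

lemma nn_integral_tilt_le:
  "(\<integral>\<^sup>+x. ennreal (tilt x) \<partial>std_normal_distribution) \<le> ennreal (49 / 50)"
proof -
  interpret prob_space std_normal_distribution by (rule prob_space_normal_density) simp
  have "(\<integral>\<^sup>+x. ennreal (tilt x) \<partial>std_normal_distribution) =
    (\<integral>\<^sup>+x. ennreal (5 / 6) + ennreal (11 / 30) * indicator {x. \<bar>x\<bar> < 1 / 2} x \<partial>std_normal_distribution)"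
    by (intro nn_integral_cong)
      (auto simp: tilt_def split: split_indicator simp flip: ennreal_plus)
  also have "\<dots> = ennreal (5 / 6) + ennreal (11 / 30) * emeasure std_normal_distribution {x. \<bar>x\<bar> < 1 / 2}"
    using emeasure_space_1 by (subst nn_integral_add) (auto simp: nn_integral_cmult)
  also have "\<dots> \<le> ennreal (5 / 6) + ennreal (11 / 30) * ennreal (2 / 5)"
    by (intro add_left_mono mult_left_mono emeasure_std_normal_central_le) auto
  also have "\<dots> = ennreal (49 / 50)"
    by (simp flip: ennreal_plus ennreal_mult)
  finally show ?thesis .
qed

text \<open>The two tilt values are reciprocal, so the product is a power of 6/5 whose exponent is
  the number of central coordinates minus the number of others.\<close>

lemma prod_tilt_ge_1:
  assumes "finite I" "real (card I) / 2 \<le> real (card {i \<in> I. \<bar>x i\<bar> < 1 / 2})"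
  shows "1 \<le> (\<Prod>i\<in>I. tilt (x i))"
proof -
  let ?Z = "{i \<in> I. \<bar>x i\<bar> < 1 / 2}" and ?W = "{i \<in> I. \<not> \<bar>x i\<bar> < 1 / 2}"
  have "card ?Z + card ?W = card I"
    using assms(1) by (subst card_Un_disjoint[symmetric]) (auto intro!: arg_cong[where f = card])
  then have le: "card ?W \<le> card ?Z" using assms(2) by linarith
  have "(\<Prod>i\<in>I. tilt (x i)) = (6 / 5) ^ card ?Z * (5 / 6) ^ card ?W"
    unfolding tilt_def using assms(1) by (subst prod.If_cases) (auto simp: Int_def conj_commute)
  also have "\<dots> = (6 / 5) ^ card ?Z / (6 / 5) ^ card ?W"
    by (simp add: power_divide)
  also have "\<dots> \<ge> 1"
    using le by (simp add: power_increasing)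
  finally show ?thesis .
qed

subsection \<open>The noise law\<close>

lemma prob_space_std_normal: "prob_space std_normal_distribution"
  by (rule prob_space_normal_density) simp

lemma measurable_noise_component [measurable]:
  "j \<in> {1..d} \<Longrightarrow> (\<lambda>\<xi>. \<xi> j) \<in> borel_measurable (noise_law d)"
  using measurable_component_singleton[of j "{1..d}" "\<lambda>_. std_normal_distribution"]
  by (simp add: noise_law_def)

lemma nn_integral_noise_component:
  assumes j: "j \<in> {1..d}" and f: "f \<in> borel_measurable borel"
  shows "(\<integral>\<^sup>+\<xi>. f (\<xi> j) \<partial>noise_law d) = (\<integral>\<^sup>+x. f x \<partial>std_normal_distribution)"
proof -
  have "(\<integral>\<^sup>+x. f x \<partial>std_normal_distribution) =
    (\<integral>\<^sup>+x. f x \<partial>distr (noise_law d) std_normal_distribution (\<lambda>\<xi>. \<xi> j))"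
    unfolding noise_law_def using j
    by (subst distr_PiM_component) (auto intro: prob_space_std_normal)
  also have "\<dots> = (\<integral>\<^sup>+\<xi>. f (\<xi> j) \<partial>noise_law d)"
    using j f by (intro nn_integral_distr) auto
  finally show ?thesis ..
qed

lemma nn_integral_noise_prod:
  assumes "\<And>i. i \<in> {1..d} \<Longrightarrow> f i \<in> borel_measurable borel"
  shows "(\<integral>\<^sup>+\<xi>. (\<Prod>i\<in>{1..d}. f i (\<xi> i)) \<partial>noise_law d) =
    (\<Prod>i\<in>{1..d}. \<integral>\<^sup>+x. f i x \<partial>std_normal_distribution)"
proof -
  interpret product_prob_space "\<lambda>_. std_normal_distribution" "{1..d}"
    by (intro product_prob_spaceI prob_space_std_normal)
  show ?thesis
    unfolding noise_law_def using assms by (intro product_nn_integral_prod) auto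
qed

lemma measurable_noise_flip:
  assumes i: "i \<in> {1..d}"
  shows "(\<lambda>\<xi>. \<xi>(i := - \<xi> i)) \<in> noise_law d \<rightarrow>\<^sub>M noise_law d"
proof -
  have "(\<lambda>\<xi>. (\<xi>(i := - \<xi> i)) j) \<in> borel_measurable (noise_law d)" if "j \<in> {1..d}" for j
    using measurable_noise_component[OF i] measurable_noise_component[OF that]
    by (cases "j = i") auto
  then show ?thesis
    unfolding noise_law_def using i
    by (intro measurable_PiM_single') (auto simp: space_PiM PiE_def extensional_def)
qed

text \<open>A product law is determined by its values on boxes. The preimage of a box under the flip
  is the box with its i-th side reflected, and the i-th factor is symmetric.\<close>

lemma distr_noise_flip:
  assumes i: "i \<in> {1..d}"
  shows "distr (noise_law d) (noise_law d) (\<lambda>\<xi>. \<xi>(i := - \<xi> i)) = noise_law d"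
proof -
  let ?N = std_normal_distribution and ?T = "\<lambda>\<xi>::nat \<Rightarrow> real. \<xi>(i := - \<xi> i)"
  interpret product_prob_space "\<lambda>_. ?N" "{1..d}"
    by (intro product_prob_spaceI prob_space_std_normal)
  note T = measurable_noise_flip[OF i]
  have "PiM {1..d} (\<lambda>_. ?N) = distr (noise_law d) (noise_law d) ?T"
  proof (rule PiM_eqI[symmetric])
    fix A assume A: "\<And>j. j \<in> {1..d} \<Longrightarrow> A j \<in> sets ?N"
    define A' where "A' j = (if j = i then uminus -` A i else A j)" for j
    have "uminus -` A i \<in> sets borel"
      using A[OF i] measurable_sets[of uminus borel borel "A i"] by simp
    then have A': "A' j \<in> sets ?N" if "j \<in> {1..d}" for j
      using A[OF that] by (simp add: A'_def)
    have eq: "emeasure ?N (A' j) = emeasure ?N (A j)" if "j \<in> {1..d}" for j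
    proof (cases "j = i")
      case True
      have "emeasure ?N (A i) = emeasure (distr ?N ?N uminus) (A i)"
        by (simp add: distr_std_normal_uminus)
      also have "\<dots> = emeasure ?N (A' i)"
        using A[OF i] by (subst emeasure_distr) (auto simp: A'_def)
      finally show ?thesis using True by simp
    qed (simp add: A'_def)
    have "emeasure (distr (noise_law d) (noise_law d) ?T) (Pi\<^sub>E {1..d} A) =
        emeasure (noise_law d) (?T -` Pi\<^sub>E {1..d} A \<inter> space (noise_law d))"
      using A by (intro emeasure_distr T) (auto simp: noise_law_def intro!: sets_PiM_I_finite)
    also have "?T -` Pi\<^sub>E {1..d} A \<inter> space (noise_law d) = Pi\<^sub>E {1..d} A'"
      using i by (fastforce simp: noise_law_def space_PiM A'_def PiE_iff extensional_def split: if_splits)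
    also have "emeasure (noise_law d) (Pi\<^sub>E {1..d} A') = (\<Prod>j\<in>{1..d}. emeasure ?N (A' j))"
      unfolding noise_law_def using A' by (intro emeasure_PiM) auto
    also have "\<dots> = (\<Prod>j\<in>{1..d}. emeasure ?N (A j))"
      using eq by (intro prod.cong) auto
    finally show "emeasure (distr (noise_law d) (noise_law d) ?T) (Pi\<^sub>E {1..d} A) =
      (\<Prod>j\<in>{1..d}. emeasure ?N (A j))" .
  qed (auto simp: noise_law_def)
  then show ?thesis by (simp add: noise_law_def)
qed

text \<open>Changing variables by the flip shows that the integral equals its own negative. A
  non-integrable \<open>g\<close> is covered too, as its Bochner integral is 0 by
  convention.\<close>

lemma integral_noise_odd_eq_0:
  fixes g :: "(nat \<Rightarrow> real) \<Rightarrow> real"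
  assumes i: "i \<in> {1..d}" and g [measurable]: "g \<in> borel_measurable (noise_law d)"
    and odd: "\<And>\<xi>. g (\<xi>(i := - \<xi> i)) = - g \<xi>"
  shows "integral\<^sup>L (noise_law d) g = 0"
proof -
  let ?T = "\<lambda>\<xi>::nat \<Rightarrow> real. \<xi>(i := - \<xi> i)"
  note T = measurable_noise_flip[OF i]
  have "integral\<^sup>L (noise_law d) g = integral\<^sup>L (distr (noise_law d) (noise_law d) ?T) g"
    by (simp add: distr_noise_flip[OF i])
  also have "\<dots> = - integral\<^sup>L (noise_law d) g"
    by (subst integral_distr[OF T g]) (simp add: odd)
  finally show ?thesis by simp
qed

subsection \<open>The risk of the thresholding estimator\<close>

locale sparse_model =
  fixes d s :: nat and \<sigma> :: real and \<theta> :: "nat \<Rightarrow> real"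
  assumes s: "s \<ge> 1" and d: "d \<ge> 3" and sd: "real s \<le> sqrt (real d)" and \<sigma>: "\<sigma> > 0"
    and sparse: "l0_norm d \<theta> \<le> s"
begin

definition supp :: "nat set" where
  "supp = {j \<in> {1..d}. \<theta> j \<noteq> 0}"

definition obs :: "(nat \<Rightarrow> real) \<Rightarrow> nat \<Rightarrow> real" where
  "obs \<xi> = (\<lambda>j\<in>{1..d}. \<theta> j + \<sigma> * \<xi> j)"

definition rate :: real where
  "rate = ln (1 + real d / (real s)\<^sup>2)"

definition \<sigma>hat :: "(nat \<Rightarrow> real) \<Rightarrow> real" where
  "\<sigma>hat \<xi> = sigma_hat d (obs \<xi>)"

text \<open>Off the support, \<sigma> times this is the term that coordinate i contributes to the
  thresholding estimator.\<close>

definition excess :: "nat \<Rightarrow> (nat \<Rightarrow> real) \<Rightarrow> real" where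
  "excess i \<xi> = (if \<bar>\<sigma> * \<xi> i\<bar> > \<sigma>hat \<xi> * sqrt (2 * rate) then \<xi> i else 0)"

lemma d1: "d \<ge> 1" using d by simp

lemma supp_subset: "supp \<subseteq> {1..d}" by (auto simp: supp_def)

lemma card_supp: "card supp \<le> s"
  using sparse by (simp add: supp_def l0_norm_def)

lemma card_supp_le_sqrt: "real (card supp) \<le> sqrt (real d)"
  using card_supp sd by linarith

lemma obs_noise: "i \<in> {1..d} - supp \<Longrightarrow> obs \<xi> i = \<sigma> * \<xi> i"
  by (auto simp: obs_def supp_def)

lemma s_squared_le: "(real s)\<^sup>2 \<le> real d"
  using power_mono[OF sd, of 2] by simp

text \<open>From s^2 \<le> d the argument of the logarithm is at least 2. The value 2/3 makes the
  squared threshold 2 \<open>rate\<close> at least 4/3, as the Gaussian tail bound demands.\<close>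

lemma rate_ge: "2 / 3 \<le> rate"
proof -
  have "1 \<le> real d / (real s)\<^sup>2"
    using s_squared_le s by (simp add: field_simps)
  then have "ln 2 \<le> rate"
    unfolding rate_def by (subst ln_le_cancel_iff) auto
  then show ?thesis using ln2_ge_two_thirds by linarith
qed

text \<open>This lets absolute constants be absorbed into the target rate.\<close>

lemma rate_scale: "2 / 3 \<le> (real s)\<^sup>2 * rate"
proof -
  have "1 * (2 / 3) \<le> (real s)\<^sup>2 * rate"
    using s rate_ge by (intro mult_mono) (auto simp: one_le_power)
  then show ?thesis by simp
qed

text \<open>Since exp(-\<open>rate\<close>) = s^2/(s^2 + d), the threshold is calibrated so that d
  Gaussian tails of this size add up to at most s^2.\<close>

lemma exp_rate: "real d * exp (- rate) \<le> (real s)\<^sup>2"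
proof -
  have pos: "0 < 1 + real d / (real s)\<^sup>2" by (simp add: add_pos_nonneg)
  have "exp (- rate) = 1 / (1 + real d / (real s)\<^sup>2)"
    using pos by (simp add: rate_def exp_minus inverse_eq_divide)
  then have "real d * exp (- rate) + exp (- rate) * (real s)\<^sup>2 = (real s)\<^sup>2"
    using s d pos by (simp add: field_simps)
  moreover have "0 \<le> exp (- rate) * (real s)\<^sup>2" by simp
  ultimately show ?thesis by linarith
qed

lemma \<sigma>hat_nonneg: "\<sigma>hat \<xi> \<ge> 0"
  unfolding \<sigma>hat_def using sigma_hat_squared(2)[OF d1] .

lemma measurable_obs_component [measurable]:
  assumes "i \<in> {1..d}"
  shows "(\<lambda>\<xi>. obs \<xi> i) \<in> borel_measurable (noise_law d)"
  using assms unfolding obs_def by (simp del: atLeastAtMost_iff)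

lemma borel_measurable_\<sigma>hat [measurable]: "\<sigma>hat \<in> borel_measurable (noise_law d)"
  unfolding \<sigma>hat_def[abs_def] by (intro borel_measurable_sigma_hat d1) simp_all

lemma borel_measurable_excess [measurable]:
  "i \<in> {1..d} \<Longrightarrow> excess i \<in> borel_measurable (noise_law d)"
  unfolding excess_def[abs_def] by measurable

section \<open>Second moments and orthogonality of the surviving noise\<close>

lemma nn_integral_noise_square:
  "i \<in> {1..d} \<Longrightarrow> (\<integral>\<^sup>+\<xi>. ennreal ((\<xi> i)\<^sup>2) \<partial>noise_law d) = 1"
  using nn_integral_noise_component[of i d "\<lambda>x. ennreal (x\<^sup>2)"] nn_integral_std_normal_square by simp

lemma nn_integral_noise_sum_squares:
  assumes "T \<subseteq> {1..d}"
  shows "(\<integral>\<^sup>+\<xi>. ennreal (\<Sum>i\<in>T. (\<xi> i)\<^sup>2) \<partial>noise_law d) = ennreal (real (card T))"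
proof -
  have "(\<integral>\<^sup>+\<xi>. ennreal (\<Sum>i\<in>T. (\<xi> i)\<^sup>2) \<partial>noise_law d) =
      (\<integral>\<^sup>+\<xi>. (\<Sum>i\<in>T. ennreal ((\<xi> i)\<^sup>2)) \<partial>noise_law d)"
    by (simp add: sum_ennreal)
  also have "\<dots> = (\<Sum>i\<in>T. \<integral>\<^sup>+\<xi>. ennreal ((\<xi> i)\<^sup>2) \<partial>noise_law d)"
    using assms by (intro nn_integral_sum measurable_compose[OF measurable_noise_component]) auto
  also have "\<dots> = (\<Sum>i\<in>T. 1)"
    using assms by (intro sum.cong nn_integral_noise_square) auto
  finally show ?thesis by (simp add: ennreal_of_nat_eq_real_of_nat)
qed

lemma integrable_noise_square:
  assumes "i \<in> {1..d}"
  shows "integrable (noise_law d) (\<lambda>\<xi>. (\<xi> i)\<^sup>2)"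
proof (rule integrableI_nonneg)
  show "(\<lambda>\<xi>. (\<xi> i)\<^sup>2) \<in> borel_measurable (noise_law d)"
    using measurable_noise_component[OF assms] by measurable
qed (auto simp: nn_integral_noise_square[OF assms])

lemma excess_bound: "\<bar>excess i \<xi>\<bar> \<le> \<bar>\<xi> i\<bar>"
  by (simp add: excess_def)

lemma integrable_excess_mult:
  assumes i: "i \<in> {1..d}" and j: "j \<in> {1..d}"
  shows "integrable (noise_law d) (\<lambda>\<xi>. excess i \<xi> * excess j \<xi>)"
proof (rule Bochner_Integration.integrable_bound)
  show "integrable (noise_law d) (\<lambda>\<xi>. (\<xi> i)\<^sup>2 + (\<xi> j)\<^sup>2)"
    using i j by (intro Bochner_Integration.integrable_add integrable_noise_square)
  show "(\<lambda>\<xi>. excess i \<xi> * excess j \<xi>) \<in> borel_measurable (noise_law d)"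
    using i j by measurable
  show "AE \<xi> in noise_law d. norm (excess i \<xi> * excess j \<xi>) \<le> norm ((\<xi> i)\<^sup>2 + (\<xi> j)\<^sup>2)"
  proof (intro AE_I2)
    fix \<xi> :: "nat \<Rightarrow> real"
    have "\<bar>excess i \<xi> * excess j \<xi>\<bar> \<le> \<bar>\<xi> i\<bar> * \<bar>\<xi> j\<bar>"
      unfolding abs_mult by (intro mult_mono excess_bound) auto
    also have "\<dots> \<le> \<bar>\<xi> i\<bar>\<^sup>2 + \<bar>\<xi> j\<bar>\<^sup>2"
      using sum_squares_bound[of "\<bar>\<xi> i\<bar>" "\<bar>\<xi> j\<bar>"] zero_le_mult_iff[of "\<bar>\<xi> i\<bar>" "\<bar>\<xi> j\<bar>"]
      unfolding mult.assoc by linarith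
    finally show "norm (excess i \<xi> * excess j \<xi>) \<le> norm ((\<xi> i)\<^sup>2 + (\<xi> j)\<^sup>2)" by simp
  qed
qed

text \<open>Off the support the observations are symmetric, and \<open>\<sigma>hat\<close> only sees their squares, so a
  sign flip of one coordinate makes the cross moments vanish.\<close>

lemma integral_excess_mult_eq_0:
  assumes i: "i \<in> {1..d} - supp" and j: "j \<in> {1..d}" and "i \<noteq> j"
  shows "(LINT \<xi>|noise_law d. excess i \<xi> * excess j \<xi>) = 0"
proof (rule integral_noise_odd_eq_0[of i])
  have i': "i \<in> {1..d}" using i by simp
  then show "i \<in> {1..d}" .
  show "(\<lambda>\<xi>. excess i \<xi> * excess j \<xi>) \<in> borel_measurable (noise_law d)"
    using i' j by measurable
  fix \<xi> :: "nat \<Rightarrow> real"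
  have "\<sigma>hat (\<xi>(i := - \<xi> i)) = \<sigma>hat \<xi>"
    unfolding \<sigma>hat_def
  proof (rule sigma_hat_cong)
    fix k assume "k \<in> {1..d}"
    then show "(obs (\<xi>(i := - \<xi> i)) k)\<^sup>2 = (obs \<xi> k)\<^sup>2"
      using i by (cases "k = i") (auto simp: obs_def supp_def)
  qed
  then show "excess i (\<xi>(i := - \<xi> i)) * excess j (\<xi>(i := - \<xi> i)) = - (excess i \<xi> * excess j \<xi>)"
    using \<open>i \<noteq> j\<close> by (simp add: excess_def)
qed

text \<open>The cross products are signed, so the square is expanded under the Bochner integral,
  where they vanish by the flip symmetry; the diagonal is then carried back to the nonnegative
  integral.\<close>

lemma nn_integral_excess_sum_square:
  "(\<integral>\<^sup>+\<xi>. ennreal ((\<Sum>i\<in>{1..d} - supp. excess i \<xi>)\<^sup>2) \<partial>noise_law d) =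
    (\<Sum>i\<in>{1..d} - supp. \<integral>\<^sup>+\<xi>. ennreal ((excess i \<xi>)\<^sup>2) \<partial>noise_law d)"
proof -
  let ?I = "{1..d} - supp"
  have sq: "(\<Sum>i\<in>?I. excess i \<xi>)\<^sup>2 = (\<Sum>i\<in>?I. \<Sum>j\<in>?I. excess i \<xi> * excess j \<xi>)" for \<xi>
    by (simp add: power2_eq_square sum_product)
  have int: "integrable (noise_law d) (\<lambda>\<xi>. (\<Sum>i\<in>?I. excess i \<xi>)\<^sup>2)"
    unfolding sq by (intro Bochner_Integration.integrable_sum integrable_excess_mult) auto
  have "(LINT \<xi>|noise_law d. (\<Sum>i\<in>?I. excess i \<xi>)\<^sup>2) =
      (\<Sum>i\<in>?I. \<Sum>j\<in>?I. LINT \<xi>|noise_law d. excess i \<xi> * excess j \<xi>)"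
    unfolding sq
    by (subst Bochner_Integration.integral_sum; intro sum.cong refl Bochner_Integration.integrable_sum
        Bochner_Integration.integral_sum integrable_excess_mult) auto
  also have "\<dots> = (\<Sum>i\<in>?I. \<Sum>j\<in>?I. if j = i then LINT \<xi>|noise_law d. (excess i \<xi>)\<^sup>2 else 0)"
    by (intro sum.cong refl) (auto simp: power2_eq_square intro: integral_excess_mult_eq_0)
  also have "\<dots> = (\<Sum>i\<in>?I. LINT \<xi>|noise_law d. (excess i \<xi>)\<^sup>2)"
    by (intro sum.cong refl) (simp add: sum.delta)
  finally have eq: "(LINT \<xi>|noise_law d. (\<Sum>i\<in>?I. excess i \<xi>)\<^sup>2) =
    (\<Sum>i\<in>?I. LINT \<xi>|noise_law d. (excess i \<xi>)\<^sup>2)" .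
  have "(\<integral>\<^sup>+\<xi>. ennreal ((\<Sum>i\<in>?I. excess i \<xi>)\<^sup>2) \<partial>noise_law d) =
      ennreal (LINT \<xi>|noise_law d. (\<Sum>i\<in>?I. excess i \<xi>)\<^sup>2)"
    by (intro nn_integral_eq_integral int) simp
  also have "\<dots> = (\<Sum>i\<in>?I. ennreal (LINT \<xi>|noise_law d. (excess i \<xi>)\<^sup>2))"
    unfolding eq by (simp add: sum_ennreal)
  also have "\<dots> = (\<Sum>i\<in>?I. \<integral>\<^sup>+\<xi>. ennreal ((excess i \<xi>)\<^sup>2) \<partial>noise_law d)"
    using integrable_excess_mult
    by (intro sum.cong refl nn_integral_eq_integral[symmetric]) (auto simp: power2_eq_square)
  finally show ?thesis .
qed

section \<open>The event that the scale is underestimated\<close>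

lemma underestimate_term_le:
  assumes i: "i \<in> {1..d}" and large: "d \<ge> 1600"
  shows "(\<integral>\<^sup>+\<xi>. ennreal (if \<sigma>hat \<xi> < \<sigma> then (\<xi> i)\<^sup>2 else 0) \<partial>noise_law d)
    \<le> ennreal (6 / 5 * (49 / 50) ^ (d - 1))"
proof -
  \<comment> \<open>One tilt per coordinate and the square at coordinate i: on the event the tilts
    multiply to at least 1, so the product dominates the integrand, and by independence its integral
    factorises.\<close>
  define g where "g j x = ennreal ((if j = i then x\<^sup>2 else 1) * tilt x)" for j :: nat and x
  have [measurable]: "g j \<in> borel_measurable borel" for j
    unfolding g_def by measurable
  have "(\<integral>\<^sup>+\<xi>. ennreal (if \<sigma>hat \<xi> < \<sigma> then (\<xi> i)\<^sup>2 else 0) \<partial>noise_law d) \<le>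
      (\<integral>\<^sup>+\<xi>. (\<Prod>j\<in>{1..d}. g j (\<xi> j)) \<partial>noise_law d)"
  proof (rule nn_integral_mono)
    fix \<xi> :: "nat \<Rightarrow> real"
    have "(\<Prod>j\<in>{1..d}. g j (\<xi> j)) = ennreal (\<Prod>j\<in>{1..d}. (if j = i then (\<xi> j)\<^sup>2 else 1) * tilt (\<xi> j))"
      unfolding g_def using tilt_pos by (intro prod_ennreal) (auto simp: less_imp_le)
    also have "\<dots> = ennreal ((\<xi> i)\<^sup>2 * (\<Prod>j\<in>{1..d}. tilt (\<xi> j)))"
      using i by (subst prod.distrib) (simp add: prod.delta)
    finally have eq: "(\<Prod>j\<in>{1..d}. g j (\<xi> j)) = ennreal ((\<xi> i)\<^sup>2 * (\<Prod>j\<in>{1..d}. tilt (\<xi> j)))" .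
    show "ennreal (if \<sigma>hat \<xi> < \<sigma> then (\<xi> i)\<^sup>2 else 0) \<le> (\<Prod>j\<in>{1..d}. g j (\<xi> j))"
    proof (cases "\<sigma>hat \<xi> < \<sigma>")
      case True
      have "real d / 2 \<le> real (card {j \<in> {1..d}. \<bar>\<xi> j\<bar> < 1 / 2})"
        using sigma_hat_less_imp[OF large supp_subset card_supp_le_sqrt \<sigma> obs_noise] True
        by (simp add: \<sigma>hat_def)
      then have "1 \<le> (\<Prod>j\<in>{1..d}. tilt (\<xi> j))"
        by (intro prod_tilt_ge_1) auto
      then have "(\<xi> i)\<^sup>2 * 1 \<le> (\<xi> i)\<^sup>2 * (\<Prod>j\<in>{1..d}. tilt (\<xi> j))"
        by (intro mult_left_mono) auto
      then show ?thesis unfolding eq using True by (simp add: ennreal_leI)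
    qed simp
  qed
  also have "\<dots> = (\<Prod>j\<in>{1..d}. \<integral>\<^sup>+x. g j x \<partial>std_normal_distribution)"
    by (intro nn_integral_noise_prod) simp
  also have "\<dots> \<le> (\<Prod>j\<in>{1..d}. ennreal (if j = i then 6 / 5 else 49 / 50))"
  proof (rule prod_mono_ennreal)
    fix j
    show "(\<integral>\<^sup>+x. g j x \<partial>std_normal_distribution) \<le> ennreal (if j = i then 6 / 5 else 49 / 50)"
    proof (cases "j = i")
      case True
      \<comment> \<open>At coordinate i the tilt is replaced by its maximum 6/5, and the second
        moment of the noise is 1.\<close>
      have "(\<integral>\<^sup>+x. g j x \<partial>std_normal_distribution) \<le>
          (\<integral>\<^sup>+x. ennreal (6 / 5) * ennreal (x\<^sup>2) \<partial>std_normal_distribution)"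
      proof (rule nn_integral_mono)
        fix x :: real
        have "x\<^sup>2 * tilt x \<le> 6 / 5 * x\<^sup>2"
          using mult_left_mono[OF tilt_le[of x], of "x\<^sup>2"] by (simp add: mult.commute)
        then show "g j x \<le> ennreal (6 / 5) * ennreal (x\<^sup>2)"
          unfolding g_def using True by (simp add: ennreal_leI flip: ennreal_mult)
      qed
      also have "\<dots> = ennreal (6 / 5)"
        by (simp add: nn_integral_cmult nn_integral_std_normal_square)
      finally show ?thesis using True by simp
    next
      case False
      then show ?thesis using nn_integral_tilt_le by (simp add: g_def)
    qed
  qed
  also have "\<dots> = ennreal (\<Prod>j\<in>{1..d}. if j = i then 6 / 5 else 49 / 50)"
    by (intro prod_ennreal) auto
  also have "(\<Prod>j\<in>{1..d}. if j = i then 6 / 5 else 49 / 50) = (6 / 5 :: real) * (49 / 50) ^ (d - 1)"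
  proof -
    have "(\<Prod>j\<in>{1..d}. if j = i then 6 / 5 else 49 / 50 :: real) =
        6 / 5 * (\<Prod>j\<in>{1..d} - {i}. if j = i then 6 / 5 else 49 / 50)"
      using i by (subst prod.remove[of _ i]) auto
    also have "(\<Prod>j\<in>{1..d} - {i}. if j = i then 6 / 5 else 49 / 50 :: real) = (\<Prod>j\<in>{1..d} - {i}. 49 / 50)"
      by (intro prod.cong) auto
    finally show ?thesis using i by simp
  qed
  finally show ?thesis .
qed

text \<open>Below dimension 1600, fewer than 1600 unit second moments are summed. From there on,
  exponential decay beats the number of terms: Bernoulli's inequality gives d/49 \<le>
  (50/49)^(d-1), so the sum is at most 49 * 6/5.\<close>

lemma underestimate_sum_le:
  "(\<Sum>i\<in>{1..d} - supp. \<integral>\<^sup>+\<xi>. ennreal (if \<sigma>hat \<xi> < \<sigma> then (\<xi> i)\<^sup>2 else 0) \<partial>noise_law d)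
    \<le> ennreal 1600" (is "?lhs \<le> _")
proof -
  define b :: real where "b = (if d \<ge> 1600 then 6 / 5 * (49 / 50) ^ (d - 1) else 1)"
  have b: "b \<ge> 0" by (simp add: b_def)
  have "?lhs \<le> (\<Sum>i\<in>{1..d} - supp. ennreal b)"
  proof (rule sum_mono)
    fix i assume "i \<in> {1..d} - supp"
    then have i: "i \<in> {1..d}" by simp
    have "(\<integral>\<^sup>+\<xi>. ennreal (if \<sigma>hat \<xi> < \<sigma> then (\<xi> i)\<^sup>2 else 0) \<partial>noise_law d) \<le>
        (\<integral>\<^sup>+\<xi>. ennreal ((\<xi> i)\<^sup>2) \<partial>noise_law d)"
      by (intro nn_integral_mono ennreal_leI) auto
    then show "(\<integral>\<^sup>+\<xi>. ennreal (if \<sigma>hat \<xi> < \<sigma> then (\<xi> i)\<^sup>2 else 0) \<partial>noise_law d) \<le> ennreal b"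
      using underestimate_term_le[OF i] nn_integral_noise_square[OF i] by (auto simp: b_def)
  qed
  also have "\<dots> = ennreal (real (card ({1..d} - supp)) * b)"
    using b by (simp add: ennreal_mult ennreal_of_nat_eq_real_of_nat)
  also have "\<dots> \<le> ennreal 1600"
  proof (rule ennreal_leI)
    have "card ({1..d} - supp) \<le> d"
      using card_mono[of "{1..d}" "{1..d} - supp"] by simp
    then have "real (card ({1..d} - supp)) * b \<le> real d * b"
      using b by (intro mult_right_mono) auto
    also have "\<dots> \<le> 1600"
    proof (cases "d \<ge> 1600")
      case True
      have "real d / 49 \<le> 1 + real (d - 1) * (1 / 49)" using d by (simp add: field_simps)
      also have "\<dots> \<le> (1 + 1 / 49) ^ (d - 1)"
        by (rule Bernoulli_inequality) simp
      finally have "real d / 49 * (49 / 50) ^ (d - 1) \<le> (50 / 49) ^ (d - 1) * (49 / 50) ^ (d - 1)"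
        by (intro mult_right_mono) auto
      also have "\<dots> = (1::real)" by (simp flip: power_mult_distrib)
      finally show ?thesis using True by (simp add: b_def)
    qed (simp add: b_def)
    finally show "real (card ({1..d} - supp)) * b \<le> 1600" .
  qed
  finally show ?thesis .
qed

text \<open>If \<open>\<sigma>hat\<close> is at least \<sigma>, survival forces the noise above the
  fixed level sqrt(2 \<open>rate\<close>), which removes the dependence on the random threshold and
  leaves a one-dimensional tail integral. Otherwise the square is kept whole.\<close>

lemma excess_square_le:
  assumes i: "i \<in> {1..d}"
  shows "(\<integral>\<^sup>+\<xi>. ennreal ((excess i \<xi>)\<^sup>2) \<partial>noise_law d) \<le> ennreal (8 * rate * exp (- rate)) +
    (\<integral>\<^sup>+\<xi>. ennreal (if \<sigma>hat \<xi> < \<sigma> then (\<xi> i)\<^sup>2 else 0) \<partial>noise_law d)"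
proof -
  note [measurable] = measurable_noise_component[OF i]
  let ?t = "sqrt (2 * rate)"
  let ?f = "\<lambda>x::real. ennreal (x\<^sup>2) * indicator {x. \<bar>x\<bar> > ?t} x"
  have t2: "?t\<^sup>2 = 2 * rate" using rate_ge by simp
  have "(\<integral>\<^sup>+\<xi>. ennreal ((excess i \<xi>)\<^sup>2) \<partial>noise_law d) \<le>
    (\<integral>\<^sup>+\<xi>. ?f (\<xi> i) + ennreal (if \<sigma>hat \<xi> < \<sigma> then (\<xi> i)\<^sup>2 else 0) \<partial>noise_law d)"
  proof (rule nn_integral_mono)
    fix \<xi> :: "nat \<Rightarrow> real"
    have "\<bar>\<xi> i\<bar> > ?t" if "\<not> \<sigma>hat \<xi> < \<sigma>" "excess i \<xi> \<noteq> 0"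
    proof -
      have "\<sigma> * ?t \<le> \<sigma>hat \<xi> * ?t"
        using that rate_ge by (intro mult_right_mono) auto
      also have "\<dots> < \<sigma> * \<bar>\<xi> i\<bar>"
        using that(2) \<sigma> by (auto simp: excess_def abs_mult split: if_splits)
      finally show ?thesis using \<sigma> by simp
    qed
    moreover have "(excess i \<xi>)\<^sup>2 \<le> (\<xi> i)\<^sup>2"
      using excess_bound by (simp add: abs_le_square_iff)
    ultimately show "ennreal ((excess i \<xi>)\<^sup>2) \<le> ?f (\<xi> i) + ennreal (if \<sigma>hat \<xi> < \<sigma> then (\<xi> i)\<^sup>2 else 0)"
      by (cases "\<sigma>hat \<xi> < \<sigma>"; cases "excess i \<xi> = 0")
        (auto intro!: ennreal_leI add_increasing)
  qed
  also have "\<dots> = (\<integral>\<^sup>+\<xi>. ?f (\<xi> i) \<partial>noise_law d) +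
      (\<integral>\<^sup>+\<xi>. ennreal (if \<sigma>hat \<xi> < \<sigma> then (\<xi> i)\<^sup>2 else 0) \<partial>noise_law d)"
    by (intro nn_integral_add) measurable
  also have "(\<integral>\<^sup>+\<xi>. ?f (\<xi> i) \<partial>noise_law d) = (\<integral>\<^sup>+x. ?f x \<partial>std_normal_distribution)"
    by (intro nn_integral_noise_component i) measurable
  also have "\<dots> \<le> ennreal (4 * ?t\<^sup>2 * exp (- ?t\<^sup>2 / 2))"
    using rate_ge by (intro nn_integral_std_normal_tail_le) auto
  also have "4 * ?t\<^sup>2 * exp (- ?t\<^sup>2 / 2) = 8 * rate * exp (- rate)"
    unfolding t2 by simp
  finally show ?thesis by (simp add: add_right_mono)
qed

lemma nn_integral_excess_sum_square_le:
  "(\<integral>\<^sup>+\<xi>. ennreal ((\<Sum>i\<in>{1..d} - supp. excess i \<xi>)\<^sup>2) \<partial>noise_law d) \<le>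
    ennreal (2408 * ((real s)\<^sup>2 * rate))"
proof -
  let ?I = "{1..d} - supp"
  let ?U = "\<lambda>i. \<integral>\<^sup>+\<xi>. ennreal (if \<sigma>hat \<xi> < \<sigma> then (\<xi> i)\<^sup>2 else 0) \<partial>noise_law d"
  have r: "rate > 0" using rate_ge by linarith
  have "(\<integral>\<^sup>+\<xi>. ennreal ((\<Sum>i\<in>?I. excess i \<xi>)\<^sup>2) \<partial>noise_law d) \<le>
      (\<Sum>i\<in>?I. ennreal (8 * rate * exp (- rate)) + ?U i)"
    unfolding nn_integral_excess_sum_square by (intro sum_mono excess_square_le) auto
  also have "\<dots> = ennreal (real (card ?I) * (8 * rate * exp (- rate))) + (\<Sum>i\<in>?I. ?U i)"
    using r by (simp add: sum.distrib ennreal_mult ennreal_of_nat_eq_real_of_nat)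
  also have "\<dots> \<le> ennreal (8 * ((real s)\<^sup>2 * rate)) + ennreal (2400 * ((real s)\<^sup>2 * rate))"
  proof (rule add_mono)
    have "card ?I \<le> d"
      using card_mono[of "{1..d}" ?I] by simp
    then have "real (card ?I) * (8 * rate * exp (- rate)) \<le> real d * (8 * rate * exp (- rate))"
      using r by (intro mult_right_mono) auto
    also have "\<dots> = 8 * rate * (real d * exp (- rate))" by simp
    also have "\<dots> \<le> 8 * rate * (real s)\<^sup>2"
      using r exp_rate by (intro mult_left_mono) auto
    finally show "ennreal (real (card ?I) * (8 * rate * exp (- rate))) \<le> ennreal (8 * ((real s)\<^sup>2 * rate))"
      by (intro ennreal_leI) (simp add: mult_ac)
    \<comment> \<open>Here 1600 = 2400 * 2/3, by \<open>rate_scale\<close>.\<close>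
    have "ennreal 1600 \<le> ennreal (2400 * ((real s)\<^sup>2 * rate))"
      using rate_scale by (intro ennreal_leI) linarith
    then show "(\<Sum>i\<in>?I. ?U i) \<le> ennreal (2400 * ((real s)\<^sup>2 * rate))"
      using underestimate_sum_le by (rule order_trans[rotated])
  qed
  also have "\<dots> = ennreal (2408 * ((real s)\<^sup>2 * rate))"
    using r by (subst ennreal_plus[symmetric]) auto
  finally show ?thesis .
qed

section \<open>The pointwise error bound and its expectation\<close>

lemma \<sigma>hat_squared_le: "(\<sigma>hat \<xi>)\<^sup>2 \<le> 9 * \<sigma>\<^sup>2 / real d * (\<Sum>i\<in>{1..d}. (\<xi> i)\<^sup>2)"
proof -
  have "(\<sigma>hat \<xi>)\<^sup>2 \<le> 9 / real d * (\<Sum>i\<in>{1..d} - supp. (obs \<xi> i)\<^sup>2)"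
    unfolding \<sigma>hat_def by (intro sigma_hat_squared_le d1 supp_subset card_supp_le_sqrt)
  also have "(\<Sum>i\<in>{1..d} - supp. (obs \<xi> i)\<^sup>2) = \<sigma>\<^sup>2 * (\<Sum>i\<in>{1..d} - supp. (\<xi> i)\<^sup>2)"
    by (simp add: obs_noise power_mult_distrib sum_distrib_left)
  also have "\<dots> \<le> \<sigma>\<^sup>2 * (\<Sum>i\<in>{1..d}. (\<xi> i)\<^sup>2)"
    by (intro mult_left_mono sum_mono2) auto
  finally show ?thesis by (simp add: mult_left_mono divide_right_mono)
qed

text \<open>The error is split into its parts on and off the support. Cauchy-Schwarz over at most s
  support coordinates costs a factor s on the first part, and the squared threshold there is
  controlled through \<open>\<sigma>hat_squared_le\<close>.\<close>

lemma square_error_le: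
  "(L_tilde d s (obs \<xi>) - L d \<theta>)\<^sup>2 \<le>
    4 * real s * \<sigma>\<^sup>2 * (\<Sum>i\<in>supp. (\<xi> i)\<^sup>2) +
    72 * (real s)\<^sup>2 * rate * \<sigma>\<^sup>2 / real d * (\<Sum>i\<in>{1..d}. (\<xi> i)\<^sup>2) +
    2 * \<sigma>\<^sup>2 * (\<Sum>i\<in>{1..d} - supp. excess i \<xi>)\<^sup>2"
proof -
  have r: "rate > 0" using rate_ge by linarith
  define \<tau> where "\<tau> = \<sigma>hat \<xi> * sqrt (2 * rate)"
  have \<tau>: "\<tau> \<ge> 0" "\<tau>\<^sup>2 = 2 * rate * (\<sigma>hat \<xi>)\<^sup>2"
    using r \<sigma>hat_nonneg by (auto simp: \<tau>_def power_mult_distrib)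
  define a where "a j = obs \<xi> j * indicator {t. \<bar>t\<bar> > \<tau>} (obs \<xi> j) - \<theta> j" for j
  have "L_tilde d s (obs \<xi>) - L d \<theta> = (\<Sum>j\<in>{1..d}. a j)"
    unfolding L_tilde_def L_def a_def \<tau>_def \<sigma>hat_def rate_def by (simp add: sum_subtractf)
  also have "\<dots> = (\<Sum>j\<in>{1..d} - supp. a j) + (\<Sum>j\<in>supp. a j)"
    using supp_subset by (intro sum.subset_diff) auto
  also have "(\<Sum>j\<in>{1..d} - supp. a j) = \<sigma> * (\<Sum>j\<in>{1..d} - supp. excess j \<xi>)"
    unfolding sum_distrib_left
  proof (intro sum.cong refl)
    fix j assume j: "j \<in> {1..d} - supp"
    then have "\<theta> j = 0" by (auto simp: supp_def)
    then show "a j = \<sigma> * excess j \<xi>"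
      by (simp add: a_def obs_noise[OF j] excess_def \<tau>_def indicator_def)
  qed
  finally have "(L_tilde d s (obs \<xi>) - L d \<theta>)\<^sup>2 =
    ((\<Sum>j\<in>supp. a j) + \<sigma> * (\<Sum>j\<in>{1..d} - supp. excess j \<xi>))\<^sup>2"
    by (simp add: add.commute)
  also have "\<dots> \<le> 2 * (\<Sum>j\<in>supp. a j)\<^sup>2 + 2 * (\<sigma> * (\<Sum>j\<in>{1..d} - supp. excess j \<xi>))\<^sup>2"
    by (smt (verit) power2_sum sum_squares_bound)
  also have "(\<Sum>j\<in>supp. a j)\<^sup>2 \<le> real s * (\<Sum>j\<in>supp. 2 * \<sigma>\<^sup>2 * (\<xi> j)\<^sup>2 + 2 * \<tau>\<^sup>2)"
  proof -
    have a2: "(a j)\<^sup>2 \<le> 2 * \<sigma>\<^sup>2 * (\<xi> j)\<^sup>2 + 2 * \<tau>\<^sup>2" if "j \<in> supp" for j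
    proof -
      have j: "obs \<xi> j = \<theta> j + \<sigma> * \<xi> j" using that supp_subset by (auto simp: obs_def)
      \<comment> \<open>A kept observation has error \<sigma> times the noise. A discarded one has
        absolute value at most \<tau>, so the lost parameter is at most \<tau> plus the absolute
        noise term.\<close>
      have "\<bar>a j\<bar> \<le> \<bar>\<sigma> * \<xi> j\<bar> + \<tau>"
        using \<tau>(1) unfolding a_def j indicator_def by auto
      then have "(a j)\<^sup>2 \<le> (\<bar>\<sigma> * \<xi> j\<bar> + \<tau>)\<^sup>2"
        using \<tau>(1) by (intro abs_le_square_iff[THEN iffD1]) auto
      also have "\<dots> \<le> 2 * \<bar>\<sigma> * \<xi> j\<bar>\<^sup>2 + 2 * \<tau>\<^sup>2"
        by (smt (verit) power2_sum sum_squares_bound)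
      finally show ?thesis by (simp add: power_mult_distrib)
    qed
    have "(\<Sum>j\<in>supp. a j)\<^sup>2 \<le> real (card supp) * (\<Sum>j\<in>supp. (a j)\<^sup>2)"
      using sum_squared_le_sum_of_squares[of a supp] by (simp add: mult.commute)
    also have "\<dots> \<le> real s * (\<Sum>j\<in>supp. 2 * \<sigma>\<^sup>2 * (\<xi> j)\<^sup>2 + 2 * \<tau>\<^sup>2)"
      using card_supp a2 by (intro mult_mono sum_mono) (auto simp: sum_nonneg)
    finally show ?thesis .
  qed
  also have "(\<Sum>j\<in>supp. 2 * \<sigma>\<^sup>2 * (\<xi> j)\<^sup>2 + 2 * \<tau>\<^sup>2) =
      2 * \<sigma>\<^sup>2 * (\<Sum>j\<in>supp. (\<xi> j)\<^sup>2) + real (card supp) * (2 * \<tau>\<^sup>2)"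
    by (simp add: sum.distrib sum_distrib_left)
  also have "real (card supp) * (2 * \<tau>\<^sup>2) \<le>
      real s * (4 * rate * (9 * \<sigma>\<^sup>2 / real d * (\<Sum>i\<in>{1..d}. (\<xi> i)\<^sup>2)))"
  proof (rule mult_mono)
    have "4 * rate * (\<sigma>hat \<xi>)\<^sup>2 \<le> 4 * rate * (9 * \<sigma>\<^sup>2 / real d * (\<Sum>i\<in>{1..d}. (\<xi> i)\<^sup>2))"
      using r \<sigma>hat_squared_le by (intro mult_left_mono) auto
    then show "2 * \<tau>\<^sup>2 \<le> 4 * rate * (9 * \<sigma>\<^sup>2 / real d * (\<Sum>i\<in>{1..d}. (\<xi> i)\<^sup>2))"
      unfolding \<tau>(2) by simp
  qed (use card_supp in auto)
  finally show ?thesis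
    using s d by (simp add: algebra_simps power2_eq_square)
qed

lemma nn_integral_square_error_le:
  "(\<integral>\<^sup>+\<xi>. ennreal ((L_tilde d s (obs \<xi>) - L d \<theta>)\<^sup>2) \<partial>noise_law d) \<le>
    ennreal (5000 * \<sigma>\<^sup>2 * (real s)\<^sup>2 * rate)"
proof -
  define A where "A = 4 * real s * \<sigma>\<^sup>2"
  define B where "B = 72 * (real s)\<^sup>2 * rate * \<sigma>\<^sup>2 / real d"
  define D where "D = 2 * \<sigma>\<^sup>2"
  have r: "rate > 0" using rate_ge by linarith
  have nonneg: "A \<ge> 0" "B \<ge> 0" "D \<ge> 0" using r by (auto simp: A_def B_def D_def)
  have meas: "(\<lambda>\<xi>. \<Sum>i\<in>T. (\<xi> i)\<^sup>2) \<in> borel_measurable (noise_law d)" if "T \<subseteq> {1..d}" for T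
    using that by (intro borel_measurable_sum borel_measurable_power measurable_noise_component) auto
  note [measurable] = meas[OF supp_subset] meas[OF order_refl]
  have [measurable]: "(\<lambda>\<xi>. \<Sum>i\<in>{1..d} - supp. excess i \<xi>) \<in> borel_measurable (noise_law d)"
    by (intro borel_measurable_sum) auto
  have "(\<integral>\<^sup>+\<xi>. ennreal ((L_tilde d s (obs \<xi>) - L d \<theta>)\<^sup>2) \<partial>noise_law d) \<le>
    (\<integral>\<^sup>+\<xi>. ennreal A * ennreal (\<Sum>i\<in>supp. (\<xi> i)\<^sup>2) + ennreal B * ennreal (\<Sum>i\<in>{1..d}. (\<xi> i)\<^sup>2) +
      ennreal D * ennreal ((\<Sum>i\<in>{1..d} - supp. excess i \<xi>)\<^sup>2) \<partial>noise_law d)"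
  proof (rule nn_integral_mono)
    fix \<xi> :: "nat \<Rightarrow> real"
    define x where "x = (\<Sum>i\<in>supp. (\<xi> i)\<^sup>2)"
    define y where "y = (\<Sum>i\<in>{1..d}. (\<xi> i)\<^sup>2)"
    define z where "z = (\<Sum>i\<in>{1..d} - supp. excess i \<xi>)\<^sup>2"
    have xyz: "0 \<le> x" "0 \<le> y" "0 \<le> z" by (auto simp: x_def y_def z_def sum_nonneg)
    have "(L_tilde d s (obs \<xi>) - L d \<theta>)\<^sup>2 \<le> A * x + B * y + D * z"
      unfolding A_def B_def D_def x_def y_def z_def by (rule square_error_le)
    then have "ennreal ((L_tilde d s (obs \<xi>) - L d \<theta>)\<^sup>2) \<le> ennreal (A * x + B * y + D * z)"
      by (rule ennreal_leI)
    also have "\<dots> = ennreal A * ennreal x + ennreal B * ennreal y + ennreal D * ennreal z"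
      using nonneg xyz by (simp add: ennreal_mult)
    finally show "ennreal ((L_tilde d s (obs \<xi>) - L d \<theta>)\<^sup>2) \<le>
      ennreal A * ennreal (\<Sum>i\<in>supp. (\<xi> i)\<^sup>2) + ennreal B * ennreal (\<Sum>i\<in>{1..d}. (\<xi> i)\<^sup>2) +
      ennreal D * ennreal ((\<Sum>i\<in>{1..d} - supp. excess i \<xi>)\<^sup>2)"
      unfolding x_def y_def z_def .
  qed
  also have "\<dots> = ennreal A * (\<integral>\<^sup>+\<xi>. ennreal (\<Sum>i\<in>supp. (\<xi> i)\<^sup>2) \<partial>noise_law d) +
      ennreal B * (\<integral>\<^sup>+\<xi>. ennreal (\<Sum>i\<in>{1..d}. (\<xi> i)\<^sup>2) \<partial>noise_law d) +
      ennreal D * (\<integral>\<^sup>+\<xi>. ennreal ((\<Sum>i\<in>{1..d} - supp. excess i \<xi>)\<^sup>2) \<partial>noise_law d)"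
    by (subst nn_integral_add; measurable?)+ (simp add: nn_integral_cmult)
  also have "\<dots> \<le> ennreal A * ennreal (real s) + ennreal B * ennreal (real d) +
      ennreal D * ennreal (2408 * ((real s)\<^sup>2 * rate))"
    unfolding nn_integral_noise_sum_squares[OF supp_subset] nn_integral_noise_sum_squares[OF order_refl]
    using card_supp
    by (intro add_mono mult_left_mono nn_integral_excess_sum_square_le) (auto intro!: ennreal_leI)
  also have "\<dots> = ennreal (A * real s + B * real d + D * (2408 * ((real s)\<^sup>2 * rate)))"
    using nonneg r by (simp flip: ennreal_mult ennreal_plus)
  also have "\<dots> \<le> ennreal (5000 * \<sigma>\<^sup>2 * (real s)\<^sup>2 * rate)"
  proof (rule ennreal_leI)
    \<comment> \<open>The coefficient is 4888 = 72 + 2 * 2408. The remaining 4 is absorbed because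
      112 \<open>rate\<close> \<ge> 4, which gives the constant 5000.\<close>
    have "A * real s + B * real d + D * (2408 * ((real s)\<^sup>2 * rate)) =
        \<sigma>\<^sup>2 * (real s)\<^sup>2 * (4 + 4888 * rate)"
      using d by (simp add: A_def B_def D_def power2_eq_square algebra_simps)
    also have "\<dots> \<le> \<sigma>\<^sup>2 * (real s)\<^sup>2 * (5000 * rate)"
      using rate_ge by (intro mult_left_mono) auto
    finally show "A * real s + B * real d + D * (2408 * ((real s)\<^sup>2 * rate)) \<le>
        5000 * \<sigma>\<^sup>2 * (real s)\<^sup>2 * rate" by (simp add: mult_ac)
  qed
  finally show ?thesis .
qed

end

section \<open>Transfer from the noise to the law of the observations\<close>

lemma borel_measurable_L_tilde:
  assumes "d \<ge> 1"
  shows "L_tilde d s \<in> borel_measurable (\<Pi>\<^sub>M j\<in>{1..d}. borel)"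
proof -
  have [measurable]: "sigma_hat d \<in> borel_measurable (\<Pi>\<^sub>M j\<in>{1..d}. borel)"
    using borel_measurable_sigma_hat[OF assms, of "\<lambda>y. y" "\<Pi>\<^sub>M j\<in>{1..d}. borel"] by simp
  show ?thesis
    unfolding L_tilde_def[abs_def] indicator_def mem_Collect_eq
    by (intro borel_measurable_sum borel_measurable_times) measurable
qed

theorem theorem10:
  shows "\<exists>C::real. C > 0 \<and>
    (\<forall>(s::nat) (d::nat) (\<sigma>::real).
       s \<ge> 1 \<longrightarrow> d \<ge> 3 \<longrightarrow> real s \<le> sqrt (real d) \<longrightarrow> \<sigma> > 0 \<longrightarrow>
       (SUP \<theta>\<in>B0 d s. \<integral>\<^sup>+ y. ennreal ((L_tilde d s y - L d \<theta>)\<^sup>2) \<partial>obs_law d \<sigma> \<theta>)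
         \<le> ennreal (C * \<sigma>\<^sup>2 * (real s)\<^sup>2 * ln (1 + real d / (real s)\<^sup>2)))"
proof (intro exI[of _ 5000] conjI allI impI SUP_least)
  fix s d :: nat and \<sigma> :: real and \<theta>
  assume asms: "s \<ge> 1" "d \<ge> 3" "real s \<le> sqrt (real d)" "\<sigma> > 0" and \<theta>: "\<theta> \<in> B0 d s"
  interpret sparse_model d s \<sigma> \<theta>
    using asms \<theta> by unfold_locales (auto simp: B0_def)
  note [measurable] = borel_measurable_L_tilde[OF d1]
  have obs: "obs \<in> noise_law d \<rightarrow>\<^sub>M (\<Pi>\<^sub>M j\<in>{1..d}. borel)"
    unfolding obs_def[abs_def] by (rule measurable_restrict) measurable
  \<comment> \<open>The risk becomes an integral over the noise, where the bound holds with a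
    constant independent of s, d, \<sigma> and \<theta>.\<close>
  have "obs_law d \<sigma> \<theta> = distr (noise_law d) (\<Pi>\<^sub>M j\<in>{1..d}. borel) obs"
    unfolding obs_law_def obs_def[abs_def] ..
  then have "(\<integral>\<^sup>+ y. ennreal ((L_tilde d s y - L d \<theta>)\<^sup>2) \<partial>obs_law d \<sigma> \<theta>) =
      (\<integral>\<^sup>+ \<xi>. ennreal ((L_tilde d s (obs \<xi>) - L d \<theta>)\<^sup>2) \<partial>noise_law d)"
    by (simp only:) (intro nn_integral_distr obs, measurable)
  also have "\<dots> \<le> ennreal (5000 * \<sigma>\<^sup>2 * (real s)\<^sup>2 * rate)"
    by (rule nn_integral_square_error_le)
  finally show "(\<integral>\<^sup>+ y. ennreal ((L_tilde d s y - L d \<theta>)\<^sup>2) \<partial>obs_law d \<sigma> \<theta>) \<le>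
      ennreal (5000 * \<sigma>\<^sup>2 * (real s)\<^sup>2 * ln (1 + real d / (real s)\<^sup>2))"
    by (simp add: rate_def)
qed simp

end
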